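(* Let $H$ be a graph with vertex set $\{1,2,\dots,k\}$, and let $G_1,G_2,\dots,G_k$ be pairwise disjoint graphs, each of order at least $3$. If every $G_i$ has property (P), then the $H$-join $H[G_1,\dots,G_k]$ has property (P).
   Context: Graphs are finite and simple. For a graph $G$ on vertex set $\{1,\dots,n\}$, $S(G)$ is the set of real symmetric $n\times n$ matrices $A$ such that for all $i\ne j$, $A_{ij}\neq 0$ if and only if $ij\in E(G)$ (diagonal entries are unrestricted). $A(i)$ denotes the principal submatrix of $A$ obtained by deleting row and column $i$, and $m_A(0)$ the multiplicity of $0$ as an eigenvalue of $A$. A vertex $i$ is a P-vertex of $A$ if $m_{A(i)}(0)-m_A(0)=1$, and $P_\nu(A)$ is the number of P-vertices of $A$. $G$ has property (P) if there exists a nonsingular $A\in S(G)$ with $P_\nu(A)=n$ (equivalently, a nonsingular $A\in S(G)$ with $\det A(i)=0$ for all $i$, i.e. $A^{-1}$ has zero diagonal). The $H$-join $H[G_1,\dots,G_k]$ is the graph obtained from the disjoint union of $G_1,\dots,G_k$ by joining every vertex of $G_i$ to every vertex of $G_j$ whenever $ij\in E(H)$. *)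

theory Defs
  imports
    "HOL-Library.Disjoint_Sets"
    "Graph_Theory.Pair_Digraph"
    "Jordan_Normal_Form.Char_Poly"
begin

text \<open>
  A finite simple graph is a \<open>pair_graph\<close>: a finite vertex set with a symmetric irreflexive
  relation \<open>parcs\<close> on it, where \<open>(u, v) \<in> parcs G\<close> means that \<open>uv\<close> is an edge.

  Matrices have rows and columns \<open>0, \<dots>, n - 1\<close>, whereas the vertices of a graph form an arbitrary
  finite set. A list \<open>vs\<close> enumerating the vertices without repetition says which vertex belongs to
  which row and column. For a graph on \<open>{1..n}\<close> the usual reading is \<open>vs = [1..<n + 1]\<close>. A different
  enumeration changes the matrices below only by a simultaneous permutation of rows and columns.
\<close>

definition S_matrices :: "'a list \<Rightarrow> 'a pair_pre_digraph \<Rightarrow> real mat set" where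
  "S_matrices vs G =
    {A \<in> carrier_mat (length vs) (length vs).
       transpose_mat A = A \<and>
       (\<forall>i<length vs. \<forall>j<length vs. i \<noteq> j \<longrightarrow> (A $$ (i, j) \<noteq> 0 \<longleftrightarrow> (vs ! i, vs ! j) \<in> parcs G))}"

text \<open>
  Algebraic multiplicity; it is \<open>0\<close> if \<open>x\<close> is not an eigenvalue. For the real symmetric matrices
  considered here it coincides with the geometric multiplicity.
\<close>

definition eigenvalue_mult :: "real mat \<Rightarrow> real \<Rightarrow> nat" where
  "eigenvalue_mult A x = Polynomial.order x (char_poly A)"

definition P_vertex :: "real mat \<Rightarrow> nat \<Rightarrow> bool" where
  "P_vertex A i \<longleftrightarrow>
    i < dim_row A \<and> int (eigenvalue_mult (mat_delete A i i) 0) - int (eigenvalue_mult A 0) = 1"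

definition P_nu :: "real mat \<Rightarrow> nat" where
  "P_nu A = card {i. P_vertex A i}"

definition property_P :: "'a pair_pre_digraph \<Rightarrow> bool" where
  "property_P G \<longleftrightarrow>
    (\<exists>vs A. distinct vs \<and> set vs = pverts G \<and> A \<in> S_matrices vs G \<and>
       invertible_mat A \<and> P_nu A = card (pverts G))"

text \<open>Meaningful when the vertex sets of the \<open>G i\<close>, \<open>i \<in> pverts H\<close>, are pairwise disjoint.\<close>

definition H_join :: "'i pair_pre_digraph \<Rightarrow> ('i \<Rightarrow> 'a pair_pre_digraph) \<Rightarrow> 'a pair_pre_digraph" where
  "H_join H G =
    \<lparr>pverts = (\<Union>i\<in>pverts H. pverts (G i)),
     parcs = (\<Union>i\<in>pverts H. parcs (G i)) \<union> (\<Union>(i, j)\<in>parcs H. pverts (G i) \<times> pverts (G j))\<rparr>"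

lemma pair_graph_H_join:
  assumes H: "pair_graph H"
    and G: "\<And>i. i \<in> pverts H \<Longrightarrow> pair_graph (G i)"
    and disj: "disjoint_family_on (\<lambda>i. pverts (G i)) (pverts H)"
  shows "pair_graph (H_join H G)"
proof -
  interpret H: pair_graph H by (rule H)
  have edge: "u \<in> pverts (G i) \<and> v \<in> pverts (G i) \<and> u \<noteq> v \<and> (v, u) \<in> parcs (G i)"
    if "i \<in> pverts H" "(u, v) \<in> parcs (G i)" for i u v
  proof -
    interpret Gi: pair_graph "G i" using G that by blast
    show ?thesis
      using that Gi.in_arcsD1 Gi.in_arcsD2 Gi.no_loops' Gi.arcs_symmetric by blast
  qed
  have cross: "i \<in> pverts H \<and> j \<in> pverts H \<and> i \<noteq> j \<and> (j, i) \<in> parcs H" if "(i, j) \<in> parcs H" for i j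
    using that H.in_arcsD1 H.in_arcsD2 H.no_loops' H.arcs_symmetric by blast
  have fin: "finite (pverts (H_join H G))"
    using G H.pair_finite_verts
    by (auto simp: H_join_def pair_graph_def pair_digraph_def pair_fin_digraph_def
          pair_fin_digraph_axioms_def)
  have wf: "u \<in> pverts (H_join H G) \<and> v \<in> pverts (H_join H G) \<and> u \<noteq> v \<and> (v, u) \<in> parcs (H_join H G)"
    if uv: "(u, v) \<in> parcs (H_join H G)" for u v
  proof -
    consider i where "i \<in> pverts H" "(u, v) \<in> parcs (G i)"
      | i j where "(i, j) \<in> parcs H" "u \<in> pverts (G i)" "v \<in> pverts (G j)"
      using uv by (auto simp: H_join_def)
    then show ?thesis
    proof cases
      case 1
      then show ?thesis using edge[OF 1] by (auto simp: H_join_def)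
    next
      case 2
      have "pverts (G i) \<inter> pverts (G j) = {}"
        using disj cross[OF 2(1)] by (auto simp: disjoint_family_on_def)
      then show ?thesis using 2 cross[OF 2(1)] by (auto simp: H_join_def)
    qed
  qed
  have "parcs (H_join H G) \<subseteq> pverts (H_join H G) \<times> pverts (H_join H G)"
    using wf by auto
  then have "finite (parcs (H_join H G))"
    using fin finite_subset by blast
  moreover have "symmetric (with_proj (H_join H G))"
    using wf by (auto simp: symmetric_def arcs_ends_def arc_to_ends_def with_proj_def
        intro!: symI)
  ultimately show ?thesis
    by unfold_locales (use fin wf in auto)
qed

end

(*
  A nonsingular symmetric A has only P-vertices iff its inverse has zero diagonal. Choose A_i for G_i
  with inverse M_i of zero diagonal and, as G_i has order at least 3, a nowhere zero x_i with
  x_i^T M_i x_i = 0. Let D and M = D^-1 be the block diagonal matrices of the A_i and M_i, X the matrix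
  with the x_i as blocks on its diagonal, and C the adjacency matrix of H. Then D + X C X^T has the
  pattern of the join, and since X^T M X = 0 its inverse is M - M X C X^T M. The diagonal blocks of
  the second term vanish with the diagonal of C, so this inverse has zero diagonal as well.
*)
theory Submission
  imports Defs
begin

section \<open>Characteristic polynomials and P-vertices of a nonsingular symmetric matrix\<close>

lemma char_poly_mat_delete:
  fixes A :: "'a::comm_ring_1 mat"
  assumes "A \<in> carrier_mat n n" "i < n"
  shows "cofactor (char_poly_matrix A) i i = char_poly (mat_delete A i i)"
proof -
  have "mat_delete (char_poly_matrix A) i i = char_poly_matrix (mat_delete A i i)"
    using assms by (intro eq_matI) (auto simp: mat_delete_def char_poly_matrix_def)
  then show ?thesis
    \<comment> \<open>Flipping \<open>mult_2\<close> turns \<open>i + i\<close> into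
      \<open>2 * i\<close>, so the cofactor sign becomes an even power of -1.\<close>
    by (simp add: cofactor_def char_poly_def flip: mult_2)
qed

lemma poly_char_poly_0:
  fixes A :: "real mat"
  assumes A: "A \<in> carrier_mat n n"
  shows "poly (char_poly A) 0 = 0 \<longleftrightarrow> det A = 0"
proof -
  have "char_matrix A 0 = A"
    using A by (intro eq_matI) (auto simp: char_matrix_def)
  then show ?thesis
    using char_poly_matrix[OF A, of 0] det_0_negate[OF A] by simp
qed

text \<open>
  With \<open>a(x)\<close> the \<open>i\<close>-th column of the adjugate of \<open>x I - A\<close>, so that \<open>a\<^sub>i(x)\<close> is the characteristic
  polynomial of \<open>A(i)\<close> and \<open>(x I - A) a(x) = c(x) e\<^sub>i\<close>, pairing with \<open>a(0)\<close> gives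
  \<open>x (a(0) \<bullet> a(x)) = - c(0) a\<^sub>i(x)\<close> as soon as \<open>a\<^sub>i(0) = 0\<close>. The factor \<open>a(0) \<bullet> a(x)\<close> does not vanish
  at \<open>0\<close>, so the zero of \<open>a\<^sub>i\<close> is simple.
\<close>

lemma order_char_poly_mat_delete:
  fixes A :: "real mat"
  assumes A: "A \<in> carrier_mat n n" and sym: "transpose_mat A = A" and det: "det A \<noteq> 0"
    and i: "i < n" and deli: "det (mat_delete A i i) = 0"
  shows "Polynomial.order 0 (char_poly (mat_delete A i i)) = 1"
proof -
  define P where "P = char_poly_matrix A"
  define c where "c = char_poly A"
  define a where "a j = adj_mat P $$ (j, i)" for j
  define q where "q = (\<Sum>l<n. Polynomial.smult (poly (a l) 0) (a l))"
  have P: "P \<in> carrier_mat n n" using A by (simp add: P_def)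
  have dim: "dim_row A = n" "dim_col A = n" using A by auto
  have Pe: "P $$ (l, j) = [:- A $$ (l, j), of_bool (l = j):]" if "l < n" "j < n" for l j
    using that dim by (simp add: P_def char_poly_matrix_def)
  have symA: "A $$ (l, j) = A $$ (j, l)" if "l < n" "j < n" for l j
    using that dim sym by (metis index_transpose_mat(1))
  have ai: "a i = char_poly (mat_delete A i i)"
    using char_poly_mat_delete[OF A i] P i by (simp add: a_def adj_mat_def P_def)
  have c0: "poly c 0 \<noteq> 0"
    using poly_char_poly_0[OF A] det by (simp add: c_def)
  have ai0: "poly (a i) 0 = 0"
    using poly_char_poly_0[OF mat_delete_carrier[OF A]] deli ai by simp
  have col: "(\<Sum>j<n. P $$ (l, j) * a j) = of_bool (l = i) * c" if "l < n" for l
  proof -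
    have "(P * adj_mat P) $$ (l, i) = (\<Sum>j<n. P $$ (l, j) * a j)"
      using that i P adj_mat(1)[OF P] by (auto simp: scalar_prod_def a_def atLeast0LessThan)
    moreover have "(P * adj_mat P) $$ (l, i) = of_bool (l = i) * c"
      using that i adj_mat(2)[OF P] by (simp add: c_def P_def char_poly_def)
    ultimately show ?thesis by simp
  qed
  \<comment> \<open>At x = 0 the matrix x I - A is -A, so A a(0) = -c(0) e_i.\<close>
  have col0: "(\<Sum>j<n. A $$ (l, j) * poly (a j) 0) = - of_bool (l = i) * poly c 0" if "l < n" for l
  proof -
    have "poly (\<Sum>j<n. P $$ (l, j) * a j) 0 = - (\<Sum>j<n. A $$ (l, j) * poly (a j) 0)"
      using that by (simp add: poly_sum Pe sum_negf)
    then show ?thesis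
      using arg_cong[OF col[OF that], of "\<lambda>p. poly p 0"] by (cases "l = i") simp_all
  qed
  have key: "x * poly q x = - poly c 0 * poly (a i) x" for x
  proof -
    \<comment> \<open>Pairing a(0) with c(x) e_i leaves only a_i(0) c(x), which is 0 by
      \<open>ai0\<close>.\<close>
    have "0 = (\<Sum>l<n. poly (a l) 0 * (of_bool (l = i) * poly c x))"
      using ai0 by (intro sum.neutral[symmetric]) auto
    also have "\<dots> = (\<Sum>l<n. poly (a l) 0 * (\<Sum>j<n. (x * of_bool (l = j) - A $$ (l, j)) * poly (a j) x))"
    proof (intro sum.cong refl)
      fix l assume "l \<in> {..<n}"
      then have "poly (\<Sum>j<n. P $$ (l, j) * a j) x = (\<Sum>j<n. (x * of_bool (l = j) - A $$ (l, j)) * poly (a j) x)"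
        by (simp add: poly_sum Pe algebra_simps)
      with \<open>l \<in> {..<n}\<close> show "poly (a l) 0 * (of_bool (l = i) * poly c x)
        = poly (a l) 0 * (\<Sum>j<n. (x * of_bool (l = j) - A $$ (l, j)) * poly (a j) x)"
        using arg_cong[OF col[of l], of "\<lambda>p. poly p x"] by (cases "l = i") simp_all
    qed
    \<comment> \<open>After the swap, symmetry of A lets it act on a(0) instead of a(x), and
      \<open>col0\<close> replaces A a(0) by -c(0) e_i.\<close>
    also have "\<dots> = (\<Sum>j<n. \<Sum>l<n. poly (a l) 0 * ((x * of_bool (l = j) - A $$ (l, j)) * poly (a j) x))"
      unfolding sum_distrib_left by (rule sum.swap)
    also have "\<dots> = (\<Sum>j<n. x * (poly (a j) 0 * poly (a j) x) + of_bool (j = i) * (poly c 0 * poly (a j) x))"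
    proof (intro sum.cong refl)
      fix j assume j: "j \<in> {..<n}"
      have "(\<Sum>l<n. poly (a l) 0 * ((x * of_bool (l = j) - A $$ (l, j)) * poly (a j) x))
        = (\<Sum>l<n. of_bool (l = j) * (x * (poly (a l) 0 * poly (a j) x)))
          - (\<Sum>l<n. A $$ (j, l) * poly (a l) 0) * poly (a j) x"
        unfolding sum_distrib_right sum_subtractf[symmetric]
        using j by (intro sum.cong refl) (simp add: symA algebra_simps)
      then show "(\<Sum>l<n. poly (a l) 0 * ((x * of_bool (l = j) - A $$ (l, j)) * poly (a j) x))
        = x * (poly (a j) 0 * poly (a j) x) + of_bool (j = i) * (poly c 0 * poly (a j) x)"
        using j by (simp add: col0 of_bool_def if_distrib[of "\<lambda>t. t * _"] sum.delta cong: if_cong)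
    qed
    also have "\<dots> = x * poly q x + poly c 0 * poly (a i) x"
      using i by (simp add: sum.distrib q_def poly_sum sum_distrib_left of_bool_def
          if_distrib[of "\<lambda>t. t * _"] sum.delta cong: if_cong)
    finally show ?thesis by simp
  qed
  \<comment> \<open>Since A a(0) has the nonzero entry -c(0), a(0) is not the zero vector. Hence
    q(0), the sum of the squares of its real entries, is positive.\<close>
  have "\<exists>l<n. poly (a l) 0 \<noteq> 0"
    using col0[OF i] c0 by (force intro: ccontr)
  then have "poly q 0 \<noteq> 0"
    by (auto simp: q_def poly_sum sum_nonneg_eq_0_iff)
  then have "q \<noteq> 0" "Polynomial.order 0 q = 0"
    by (auto intro: order_0I)
  \<comment> \<open>Two real polynomials that agree at every point are equal, so up to a nonzero
    constant a_i is x q(x), whose order at 0 is 1 + 0.\<close>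
  moreover have "Polynomial.smult (- poly c 0) (a i) = [:0, 1:] * q"
    using key by (intro poly_ext) simp
  then have "Polynomial.order 0 (a i) = Polynomial.order 0 ([:0, 1:] * q)"
    using c0 by (metis neg_equal_0_iff_equal order_smult)
  moreover have "Polynomial.order 0 [:0, 1 :: real:] = 1"
    using order_power_n_n[of 0 1] by simp
  moreover have "[:0, 1:] * q \<noteq> 0"
    using \<open>q \<noteq> 0\<close> by simp
  ultimately show ?thesis
    using ai by (simp add: order_mult del: mult_pCons_left)
qed

text \<open>The adjugate of A is det A times its inverse, so det A(i) = det A * M_ii. As 0 is not an
  eigenvalue of A, a P-vertex is an index where 0 has multiplicity exactly 1 in A(i). That
  multiplicity is 0 if det A(i) is nonzero and, by \<open>order_char_poly_mat_delete\<close>, 1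
  otherwise.\<close>

lemma P_vertex_iff_inverse_diag:
  fixes A :: "real mat"
  assumes A: "A \<in> carrier_mat n n" and sym: "transpose_mat A = A" 
    and M: "M \<in> carrier_mat n n" and AM: "A * M = 1\<^sub>m n" and i: "i < n"
  shows "P_vertex A i \<longleftrightarrow> M $$ (i, i) = 0"
proof -
  have "det A * det M = 1"
    using det_mult[OF A M] AM by simp
  then have det: "det A \<noteq> 0" by auto
  have "adj_mat A = adj_mat A * (A * M)"
    using AM adj_mat(1)[OF A] by simp
  also have "\<dots> = (adj_mat A * A) * M"
    using A M adj_mat(1)[OF A] by (simp add: assoc_mult_mat)
  also have "\<dots> = det A \<cdot>\<^sub>m M"
    using M by (simp add: adj_mat(3)[OF A] mult_smult_assoc_mat[of _ n n _ n])
  finally have "adj_mat A $$ (i, i) = det A * M $$ (i, i)"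
    using M i by simp
  then have "det (mat_delete A i i) = det A * M $$ (i, i)"
    using A i by (simp add: adj_mat_def cofactor_def flip: mult_2)
  then have diag: "M $$ (i, i) = 0 \<longleftrightarrow> det (mat_delete A i i) = 0"
    using det by simp
  have "eigenvalue_mult A 0 = 0"
    unfolding eigenvalue_mult_def using poly_char_poly_0[OF A] det by (simp add: order_0I)
  then have "P_vertex A i \<longleftrightarrow> Polynomial.order 0 (char_poly (mat_delete A i i)) = 1"
    using A i by (auto simp: P_vertex_def eigenvalue_mult_def)
  moreover have "Polynomial.order 0 (char_poly (mat_delete A i i)) = 0"
    if "det (mat_delete A i i) \<noteq> 0"
    using that poly_char_poly_0[OF mat_delete_carrier[OF A]] by (simp add: order_0I)
  ultimately show ?thesis
    using diag order_char_poly_mat_delete[OF A sym det i] by fastforce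
qed

lemma P_nu_eq_iff_inverse_diag:
  fixes A :: "real mat"
  assumes A: "A \<in> carrier_mat n n" and sym: "transpose_mat A = A" 
    and M: "M \<in> carrier_mat n n" and AM: "A * M = 1\<^sub>m n"
  shows "P_nu A = n \<longleftrightarrow> (\<forall>i<n. M $$ (i, i) = 0)"
proof -
  have sub: "{i. P_vertex A i} \<subseteq> {..<n}"
    using A by (auto simp: P_vertex_def)
  have "P_nu A = n \<longleftrightarrow> {i. P_vertex A i} = {..<n}"
    unfolding P_nu_def using card_subset_eq[OF finite_lessThan sub] card_lessThan by metis
  also have "\<dots> \<longleftrightarrow> (\<forall>i<n. P_vertex A i)"
    using sub by auto
  finally show ?thesis
    using P_vertex_iff_inverse_diag[OF A sym M AM] by simp
qed

section \<open>Symmetric matrices indexed by vertices, with an inverse of zero diagonal\<close>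

text \<open>Indexing by vertices instead of positions lets blocks over different vertex sets be
  assembled without reindexing. Values outside \<open>V\<close> are unconstrained. Only one of the
  two products is required to be the identity; transposing it gives the other.\<close>

definition zero_diag_inverse :: "'a set \<Rightarrow> ('a \<Rightarrow> 'a \<Rightarrow> real) \<Rightarrow> ('a \<Rightarrow> 'a \<Rightarrow> real) \<Rightarrow> bool" where
  "zero_diag_inverse V a m \<longleftrightarrow>
    (\<forall>u\<in>V. \<forall>v\<in>V. a u v = a v u \<and> m u v = m v u \<and> (\<Sum>w\<in>V. a u w * m w v) = of_bool (u = v))
    \<and> (\<forall>u\<in>V. m u u = 0)"

lemma zero_diag_inverseD:
  assumes "zero_diag_inverse V a m" "u \<in> V"
  shows "m u u = 0"
    and "v \<in> V \<Longrightarrow> a u v = a v u"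
    and "v \<in> V \<Longrightarrow> m u v = m v u"
    and "v \<in> V \<Longrightarrow> (\<Sum>w\<in>V. a u w * m w v) = of_bool (u = v)"
    and "v \<in> V \<Longrightarrow> (\<Sum>w\<in>V. m u w * a w v) = of_bool (u = v)"
proof -
  show "m u u = 0" "v \<in> V \<Longrightarrow> a u v = a v u" "v \<in> V \<Longrightarrow> m u v = m v u"
    and 1: "v \<in> V \<Longrightarrow> (\<Sum>w\<in>V. a u w * m w v) = of_bool (u = v)"
    using assms unfolding zero_diag_inverse_def by blast+
  assume v: "v \<in> V"
  have "(\<Sum>w\<in>V. m u w * a w v) = (\<Sum>w\<in>V. a v w * m w u)"
    using assms v unfolding zero_diag_inverse_def by (intro sum.cong refl) (metis mult.commute)
  also have "\<dots> = of_bool (v = u)"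
    using assms v unfolding zero_diag_inverse_def by blast
  finally show "(\<Sum>w\<in>V. m u w * a w v) = of_bool (u = v)"
    by (simp add: eq_commute)
qed

lemma zero_diag_inverse_cong:
  assumes "zero_diag_inverse V a m" "\<And>u v. u \<in> V \<Longrightarrow> a u v = a' u v"
  shows "zero_diag_inverse V a' m"
  unfolding zero_diag_inverse_def
proof (intro conjI ballI)
  fix u v assume uv: "u \<in> V" "v \<in> V"
  note D = zero_diag_inverseD[OF assms(1) uv(1)]
  show "a' u v = a' v u"
    using D(2)[OF uv(2)] assms(2) uv by simp
  show "m u v = m v u"
    by (rule D(3)[OF uv(2)])
  show "(\<Sum>w\<in>V. a' u w * m w v) = of_bool (u = v)"
    unfolding D(4)[OF uv(2), symmetric] using assms(2) uv by (intro sum.cong refl) simp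
qed (rule zero_diag_inverseD(1)[OF assms(1)])

lemma property_P_imp_zero_diag_inverse:
  assumes "property_P G"
  obtains a m where "zero_diag_inverse (pverts G) a m"
    and "\<And>u v. u \<in> pverts G \<Longrightarrow> v \<in> pverts G \<Longrightarrow> u \<noteq> v \<Longrightarrow> a u v \<noteq> 0 \<longleftrightarrow> (u, v) \<in> parcs G"
proof -
  obtain vs A where vs: "distinct vs" "set vs = pverts G" and S: "A \<in> S_matrices vs G"
    and inv: "invertible_mat A" and P: "P_nu A = card (pverts G)"
    using assms unfolding property_P_def by blast
  define n where "n = length vs"
  have n: "card (pverts G) = n"
    using vs distinct_card unfolding n_def by metis
  have A: "A \<in> carrier_mat n n" and sym: "transpose_mat A = A"
    and edge: "\<And>i j. i < n \<Longrightarrow> j < n \<Longrightarrow> i \<noteq> j \<Longrightarrow> A $$ (i, j) \<noteq> 0 \<longleftrightarrow> (vs ! i, vs ! j) \<in> parcs G"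
    using S unfolding S_matrices_def n_def by auto
  obtain M where AM: "A * M = 1\<^sub>m n" and MA: "M * A = 1\<^sub>m (dim_row M)"
    using inv A unfolding invertible_mat_def inverts_mat_def by auto
  \<comment> \<open>The size of \<open>M\<close> is read off the two products: \<open>A * M\<close>
    has as many columns as \<open>M\<close>, and \<open>M * A\<close> has as many as
    \<open>A\<close>.\<close>
  have M: "M \<in> carrier_mat n n"
    using arg_cong[OF AM, of dim_col] arg_cong[OF MA, of dim_col] A by auto
  have MA: "M * A = 1\<^sub>m n" using MA M by simp
  \<comment> \<open>Transposing A M = 1 gives M^T A = 1, whence M^T = M^T (A M) = (M^T A) M =
    M.\<close>
  have "transpose_mat M * A = 1\<^sub>m n"
    using transpose_mult[OF A M] AM sym by simp
  then have "transpose_mat M * A * M = M"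
    using M by simp
  then have symM: "transpose_mat M = M"
    using A M AM by (simp add: assoc_mult_mat[of _ n n _ n _ n])
  have diag: "M $$ (i, i) = 0" if "i < n" for i
    using P_nu_eq_iff_inverse_diag[OF A sym M AM] P n that by simp
  define f where "f = the_inv_into {..<n} ((!) vs)"
  have bij: "bij_betw ((!) vs) {..<n} (pverts G)"
    using vs bij_betw_nth n_def by blast
  have f: "f u < n" "vs ! f u = u" if "u \<in> pverts G" for u
    using that bij the_inv_into_into[of "(!) vs" "{..<n}" u "{..<n}"]
      f_the_inv_into_f[of "(!) vs" "{..<n}" u] unfolding bij_betw_def f_def by auto
  have fnth: "f (vs ! i) = i" if "i < n" for i
    using that bij by (auto simp: f_def bij_betw_def the_inv_into_f_f)
  show thesis
  proof
    show "zero_diag_inverse (pverts G) (\<lambda>u v. A $$ (f u, f v)) (\<lambda>u v. M $$ (f u, f v))"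
      unfolding zero_diag_inverse_def
    proof (intro conjI ballI)
      fix u v assume uv: "u \<in> pverts G" "v \<in> pverts G"
      show "A $$ (f u, f v) = A $$ (f v, f u)"
        using uv f A sym by (metis carrier_matD index_transpose_mat(1))
      show "M $$ (f u, f v) = M $$ (f v, f u)"
        using uv f M symM by (metis carrier_matD index_transpose_mat(1))
      have "(\<Sum>w\<in>pverts G. A $$ (f u, f w) * M $$ (f w, f v)) = (\<Sum>j<n. A $$ (f u, j) * M $$ (j, f v))"
        using sum.reindex_bij_betw[OF bij, of "\<lambda>w. A $$ (f u, f w) * M $$ (f w, f v)"]
        by (simp add: fnth)
      also have "\<dots> = (A * M) $$ (f u, f v)"
        using uv f A M by (auto simp: scalar_prod_def atLeast0LessThan)
      also have "\<dots> = of_bool (u = v)"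
        using uv f AM by (auto, metis)
      finally show "(\<Sum>w\<in>pverts G. A $$ (f u, f w) * M $$ (f w, f v)) = of_bool (u = v)" .
    qed (use f diag in auto)
    show "A $$ (f u, f v) \<noteq> 0 \<longleftrightarrow> (u, v) \<in> parcs G"
      if "u \<in> pverts G" "v \<in> pverts G" "u \<noteq> v" for u v
      using edge[of "f u" "f v"] f that by metis
  qed
qed

lemma zero_diag_inverse_imp_property_P:
  assumes fin: "finite (pverts G)" and z: "zero_diag_inverse (pverts G) a m"
    and edge: "\<And>u v. u \<in> pverts G \<Longrightarrow> v \<in> pverts G \<Longrightarrow> u \<noteq> v \<Longrightarrow> a u v \<noteq> 0 \<longleftrightarrow> (u, v) \<in> parcs G"
  shows "property_P G"
proof -
  obtain vs where vs: "distinct vs" "set vs = pverts G"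
    using finite_distinct_list[OF fin] by blast
  define n where "n = length vs"
  have n: "card (pverts G) = n"
    using vs distinct_card unfolding n_def by metis
  have nth: "vs ! i \<in> pverts G" if "i < n" for i
    using nth_mem[of i vs] vs(2) that by (simp add: n_def)
  have eq: "vs ! i = vs ! j \<longleftrightarrow> i = j" if "i < n" "j < n" for i j
    using nth_eq_iff_index_eq[OF vs(1), of i j] that by (simp add: n_def)
  define A where "A = mat n n (\<lambda>(i, j). a (vs ! i) (vs ! j))"
  define M where "M = mat n n (\<lambda>(i, j). m (vs ! i) (vs ! j))"
  have A: "A \<in> carrier_mat n n" and M: "M \<in> carrier_mat n n"
    by (auto simp: A_def M_def)
  have sym: "transpose_mat A = A"
    using zero_diag_inverseD(2)[OF z] nth by (intro eq_matI) (auto simp: A_def)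
  have bij: "bij_betw ((!) vs) {..<n} (pverts G)"
    using vs bij_betw_nth n_def by blast
  have AM: "A * M = 1\<^sub>m n"
  proof (intro eq_matI)
    fix i j assume "i < dim_row (1\<^sub>m n :: real mat)" "j < dim_col (1\<^sub>m n :: real mat)"
    then have ij: "i < n" "j < n" by auto
    then have "(A * M) $$ (i, j) = (\<Sum>l<n. a (vs ! i) (vs ! l) * m (vs ! l) (vs ! j))"
      by (auto simp: scalar_prod_def A_def M_def atLeast0LessThan)
    also have "\<dots> = (\<Sum>w\<in>pverts G. a (vs ! i) w * m w (vs ! j))"
      by (rule sum.reindex_bij_betw[OF bij])
    also have "\<dots> = of_bool (i = j)"
      using zero_diag_inverseD(4)[OF z] nth ij eq by simp
    finally show "(A * M) $$ (i, j) = 1\<^sub>m n $$ (i, j)"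
      using ij by simp
  qed (auto simp: A_def M_def)
  have "M $$ (i, i) = 0" if "i < n" for i
    using zero_diag_inverseD(1)[OF z] nth that by (simp add: M_def)
  then have "P_nu A = card (pverts G)"
    using P_nu_eq_iff_inverse_diag[OF A sym M AM] n by simp
  moreover have "invertible_mat A"
    using A M AM mat_mult_left_right_inverse[OF A M AM]
    by (auto simp: invertible_mat_def inverts_mat_def)
  moreover have "A \<in> S_matrices vs G"
    using A sym edge nth eq by (auto simp: S_matrices_def n_def[symmetric] A_def)
  ultimately show ?thesis
    unfolding property_P_def using vs by blast
qed

section \<open>Generic vectors and nowhere zero isotropic vectors\<close>

text \<open>A substitute for multivariate polynomials: only the restrictions to lines have to be
  univariate polynomials, which suffices for the genericity argument.\<close>

definition poly_on_lines :: "(('a \<Rightarrow> real) \<Rightarrow> real) \<Rightarrow> bool" where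
  "poly_on_lines f \<longleftrightarrow> (\<forall>p q. \<exists>P. \<forall>t. f (\<lambda>u. p u + t * (q u - p u)) = poly P t)"

lemma poly_on_lines_const: "poly_on_lines (\<lambda>_. c)"
  unfolding poly_on_lines_def by (intro allI exI[of _ "[:c:]"]) simp

lemma poly_on_lines_coord: "poly_on_lines (\<lambda>x. x u)"
  unfolding poly_on_lines_def
proof (intro allI)
  fix p q :: "_ \<Rightarrow> real"
  show "\<exists>P. \<forall>t. p u + t * (q u - p u) = poly P t"
    by (rule exI[of _ "[:p u, q u - p u:]"]) simp
qed

lemma poly_on_lines_add:
  assumes "poly_on_lines f" "poly_on_lines g"
  shows "poly_on_lines (\<lambda>x. f x + g x)"
  unfolding poly_on_lines_def
proof (intro allI)
  fix p q :: "'a \<Rightarrow> real"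
  obtain F K where "\<forall>t. f (\<lambda>u. p u + t * (q u - p u)) = poly F t"
    "\<forall>t. g (\<lambda>u. p u + t * (q u - p u)) = poly K t"
    using assms[unfolded poly_on_lines_def, THEN spec[of _ p], THEN spec[of _ q]] by (elim exE)
  then show "\<exists>P. \<forall>t. f (\<lambda>u. p u + t * (q u - p u)) + g (\<lambda>u. p u + t * (q u - p u)) = poly P t"
    by (intro exI[of _ "F + K"]) simp
qed

lemma poly_on_lines_mult:
  assumes "poly_on_lines f" "poly_on_lines g"
  shows "poly_on_lines (\<lambda>x. f x * g x)"
  unfolding poly_on_lines_def
proof (intro allI)
  fix p q :: "'a \<Rightarrow> real"
  obtain F K where "\<forall>t. f (\<lambda>u. p u + t * (q u - p u)) = poly F t"
    "\<forall>t. g (\<lambda>u. p u + t * (q u - p u)) = poly K t"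
    using assms[unfolded poly_on_lines_def, THEN spec[of _ p], THEN spec[of _ q]] by (elim exE)
  then show "\<exists>P. \<forall>t. f (\<lambda>u. p u + t * (q u - p u)) * g (\<lambda>u. p u + t * (q u - p u)) = poly P t"
    by (intro exI[of _ "F * K"]) simp
qed

lemma poly_on_lines_sum:
  assumes "\<And>i. i \<in> I \<Longrightarrow> poly_on_lines (f i)"
  shows "poly_on_lines (\<lambda>x. \<Sum>i\<in>I. f i x)"
  using assms
  by (induction I rule: infinite_finite_induct) (simp_all add: poly_on_lines_const poly_on_lines_add)

lemma poly_on_lines_prod:
  assumes "\<And>i. i \<in> I \<Longrightarrow> poly_on_lines (f i)"
  shows "poly_on_lines (\<lambda>x. \<Prod>i\<in>I. f i x)"
  using assms
  by (induction I rule: infinite_finite_induct) (simp_all add: poly_on_lines_const poly_on_lines_mult)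

text \<open>On the line through \<open>p\<close> and \<open>q\<close>, \<open>f\<close> is nonzero
  at t = 0 and \<open>g\<close> at t = 1. Both restrictions are therefore nonzero polynomials, and
  so is their product, which cannot vanish at every real t.\<close>

lemma poly_on_lines_common_nonzero:
  assumes "poly_on_lines f" "poly_on_lines g" "f p \<noteq> 0" "g q \<noteq> 0"
  shows "\<exists>x. f x * g x \<noteq> 0"
proof -
  obtain F where F: "\<And>t. f (\<lambda>u. p u + t * (q u - p u)) = poly F t"
    using assms(1) unfolding poly_on_lines_def by metis
  obtain K where K: "\<And>t. g (\<lambda>u. p u + t * (q u - p u)) = poly K t"
    using assms(2) unfolding poly_on_lines_def by metis
  have "poly F 0 \<noteq> 0" "poly K 1 \<noteq> 0"
    using F[of 0] K[of 1] assms(3,4) by auto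
  then have "F * K \<noteq> 0" by auto
  then obtain t where "poly (F * K) t \<noteq> 0"
    using poly_all_0_iff_0 by blast
  then show ?thesis
    using F K by (metis poly_mult)
qed

text \<open>
  The quadratic form is affine in each coordinate, so for generic values of the other coordinates
  it has a unique zero in the \<open>i\<close>-th one, and this zero is not \<open>0\<close>. Genericity needs a nonzero entry
  of \<open>m\<close> outside row and column \<open>i\<close>; otherwise the rank of \<open>m\<close> would be at most \<open>2\<close>.
\<close>

lemma nowhere_zero_isotropic_vector:
  assumes z: "zero_diag_inverse V a m" and card: "card V \<ge> 3"
  shows "\<exists>x. (\<forall>u\<in>V. x u \<noteq> 0) \<and> (\<Sum>u\<in>V. x u * (\<Sum>v\<in>V. m u v * x v)) = 0"
proof -
  note D = zero_diag_inverseD[OF z]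
  have fin: "finite V" using card by (metis card.infinite not_numeral_le_zero)
  obtain i j k where ijk: "i \<in> V" "j \<in> V" "k \<in> V" "i \<noteq> j" "i \<noteq> k" "j \<noteq> k"
    using card by (auto simp: numeral_3_eq_3 card_le_Suc_iff)
  define U where "U = V - {i}"
  have U: "finite U" "V = insert i U" "i \<notin> U" using fin ijk by (auto simp: U_def)
  have "\<exists>s\<in>U. m i s \<noteq> 0"
  proof (rule ccontr)
    assume "\<not> ?thesis"
    then have "(\<Sum>w\<in>V. m i w * a w i) = 0"
      using U D(1)[of i] by (intro sum.neutral) auto
    then show False using D(5)[OF ijk(1) ijk(1)] by simp
  qed
  then obtain s where s: "s \<in> U" "m i s \<noteq> 0" by blast
  have "\<exists>j'\<in>U. \<exists>k'\<in>U. m j' k' \<noteq> 0"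
  proof (rule ccontr)
    assume none: "\<not> ?thesis"
    \<comment> \<open>If \<open>m\<close> vanished on \<open>U\<close>, only the term at
      \<open>i\<close> would survive in the product of \<open>m\<close> and \<open>a\<close>, making
      the identity on \<open>U\<close> a matrix of rank at most one. The two distinct elements
      \<open>j\<close> and \<open>k\<close> of \<open>U\<close> rule this out; here the order at
      least 3 enters.\<close>
    have row: "m u i * a i v = of_bool (u = v)" if "u \<in> U" "v \<in> V" for u v
    proof -
      have "(\<Sum>w\<in>V. m u w * a w v) = m u i * a i v"
        using none that U by (simp add: sum.insert)
      then show ?thesis using D(5)[of u v] that U by auto
    qed
    have "j \<in> U" "k \<in> U" using ijk by (auto simp: U_def)
    then show False
      using row[of j j] row[of j k] row[of k k] ijk by auto
  qed
  then obtain j' k' where jk: "j' \<in> U" "k' \<in> U" "m j' k' \<noteq> 0" by blast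
  then have jk_ne: "j' \<noteq> k'" using D(1) U by auto
  \<comment> \<open>When the \<open>i\<close>-th coordinate is t, the form is 2 t L + R, because
    \<open>m i i = 0\<close> and \<open>m\<close> is symmetric. \<open>Z\<close> is nonzero when no
    coordinate over \<open>V\<close> vanishes.\<close>
  define Z where "Z x = (\<Prod>u\<in>V. x u)" for x :: "'a \<Rightarrow> real"
  define L where "L x = (\<Sum>v\<in>U. m i v * x v)" for x
  define R where "R x = (\<Sum>u\<in>U. x u * (\<Sum>v\<in>U. m u v * x v))" for x
  have lines: "poly_on_lines Z" "poly_on_lines L" "poly_on_lines R"
    unfolding Z_def L_def R_def
    by (intro poly_on_lines_prod poly_on_lines_sum poly_on_lines_mult poly_on_lines_const
        poly_on_lines_coord)+
  have Z1: "Z (\<lambda>_. 1) \<noteq> 0" by (simp add: Z_def)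
  have "L (\<lambda>v. of_bool (v = s)) = m i s"
    using s U by (simp add: L_def)
  then have L1: "L (\<lambda>v. of_bool (v = s)) \<noteq> 0" using s by simp
  \<comment> \<open>On the sum of two unit vectors the diagonal of \<open>m\<close> contributes
    nothing and the two mixed terms agree by symmetry.\<close>
  have R1: "R (\<lambda>v. of_bool (v = j') + of_bool (v = k')) \<noteq> 0"
  proof -
    have "R (\<lambda>v. of_bool (v = j') + of_bool (v = k'))
      = (m j' j' + m j' k') + (m k' j' + m k' k')"
      using jk U by (simp add: R_def algebra_simps sum.distrib)
    also have "\<dots> = 2 * m j' k'"
      using D(1)[of j'] D(1)[of k'] D(3)[of j' k'] jk U by simp
    finally show ?thesis using jk by simp
  qed
  obtain y where y: "Z y * L y \<noteq> 0"
    using poly_on_lines_common_nonzero[of Z L, OF lines(1,2) Z1 L1] by (rule exE)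
  obtain x where "Z x * L x * R x \<noteq> 0"
    using poly_on_lines_common_nonzero[of "\<lambda>x. Z x * L x" R,
        OF poly_on_lines_mult[OF lines(1,2)] lines(3) y R1] by (rule exE)
  then have x: "L x \<noteq> 0" "R x \<noteq> 0" "\<And>u. u \<in> V \<Longrightarrow> x u \<noteq> 0"
    using fin by (auto simp: Z_def)
  \<comment> \<open>The root of 2 t L + R; it is nonzero because R is.\<close>
  define c where "c = - R x / (2 * L x)"
  define x' where "x' = x(i := c)"
  have upd: "x' u = x u" if "u \<in> U" for u using that U by (auto simp: x'_def)
  have "(\<Sum>u\<in>V. x' u * (\<Sum>v\<in>V. m u v * x' v))
    = c * L x + (\<Sum>u\<in>U. x u * (m u i * c + (\<Sum>v\<in>U. m u v * x v)))"
    using U D(1)[of i] by (simp add: L_def upd x'_def[THEN fun_cong, of i] cong: sum.cong)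
  also have "(\<Sum>u\<in>U. x u * (m u i * c + (\<Sum>v\<in>U. m u v * x v))) = c * L x + R x"
    unfolding L_def R_def sum_distrib_left[of c] sum.distrib[symmetric]
    using D(3)[of _ i] U by (intro sum.cong refl) (auto simp: algebra_simps)
  also have "c * L x + (c * L x + R x) = 0"
    using x by (simp add: c_def field_simps)
  finally have "(\<Sum>u\<in>V. x' u * (\<Sum>v\<in>V. m u v * x' v)) = 0" .
  moreover have "x' u \<noteq> 0" if "u \<in> V" for u
    using that x by (auto simp: x'_def c_def)
  ultimately show ?thesis by (intro exI[of _ x'] conjI ballI)
qed

section \<open>The inverse of the joined matrix\<close>

text \<open>With Y = M X, the product (A + X C X^T)(M - Y C Y^T) has four terms. A M is the
  identity, A Y C Y^T and X C X^T M both equal X C Y^T and cancel, and X C (X^T Y) C Y^T vanishes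
  because x is isotropic in every block. The function \<open>b\<close> gives the block of a
  vertex.\<close>

lemma zero_diag_inverse_join:
  fixes V :: "'i \<Rightarrow> 'a set" and c :: "'i \<Rightarrow> 'i \<Rightarrow> real" and b :: "'a \<Rightarrow> 'i"
  assumes finI: "finite I" and fin: "\<And>i. i \<in> I \<Longrightarrow> finite (V i)"
    and b: "\<And>i u. i \<in> I \<Longrightarrow> u \<in> V i \<Longrightarrow> b u = i"
    and z: "\<And>i. i \<in> I \<Longrightarrow> zero_diag_inverse (V i) (a i) (m i)"
    and iso: "\<And>i. i \<in> I \<Longrightarrow> (\<Sum>u\<in>V i. x u * (\<Sum>v\<in>V i. m i u v * x v)) = 0"
    and c: "\<And>i j. i \<in> I \<Longrightarrow> j \<in> I \<Longrightarrow> c i j = c j i" "\<And>i. i \<in> I \<Longrightarrow> c i i = 0"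
  shows "\<exists>n. zero_diag_inverse (\<Union>i\<in>I. V i)
    (\<lambda>u v. if b u = b v then a (b u) u v else c (b u) (b v) * (x u * x v)) n"
proof -
  define W where "W = (\<Union>i\<in>I. V i)"
  have bI: "b u \<in> I" "u \<in> V (b u)" if "u \<in> W" for u
    using that b by (auto simp: W_def)
  have VW: "u \<in> W" if "i \<in> I" "u \<in> V i" for i u
    using that by (auto simp: W_def)
  define y where "y u = (\<Sum>v\<in>V (b u). m (b u) u v * x v)" for u
  define A where "A u v = of_bool (b u = b v) * a (b u) u v" for u v
  define M where "M u v = of_bool (b u = b v) * m (b u) u v" for u v
  have ay: "(\<Sum>w\<in>V i. a i u w * y w) = x u" if i: "i \<in> I" "u \<in> V i" for i u
  proof -
    have "(\<Sum>w\<in>V i. a i u w * y w) = (\<Sum>w\<in>V i. \<Sum>v\<in>V i. a i u w * m i w v * x v)"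
      using b[OF i(1)] by (simp add: y_def sum_distrib_left mult.assoc)
    also have "\<dots> = (\<Sum>v\<in>V i. (\<Sum>w\<in>V i. a i u w * m i w v) * x v)"
      by (subst sum.swap) (simp add: sum_distrib_right)
    also have "\<dots> = (\<Sum>v\<in>V i. of_bool (u = v) * x v)"
      using zero_diag_inverseD(4)[OF z[OF i(1)] i(2)] by simp
    also have "\<dots> = x u"
      using i fin[OF i(1)] by simp
    finally show ?thesis .
  qed
  have xy: "(\<Sum>w\<in>V i. x w * y w) = 0" if i: "i \<in> I" for i
    using iso[OF i] b[OF i] by (simp add: y_def)
  have block: "(\<Sum>w\<in>W. of_bool (b w = i) * f w) = (\<Sum>w\<in>V i. f w)" if i: "i \<in> I" for i and f :: "'a \<Rightarrow> real"
  proof -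
    have "(\<Sum>w\<in>V i. f w) = (\<Sum>w\<in>V i. of_bool (b w = i) * f w)"
      using b i by simp
    also have "\<dots> = (\<Sum>w\<in>W. of_bool (b w = i) * f w)"
      using bI VW i finI fin by (intro sum.mono_neutral_left) (auto simp: W_def)
    finally show ?thesis by simp
  qed
  have "zero_diag_inverse W (\<lambda>u v. A u v + c (b u) (b v) * (x u * x v))
    (\<lambda>u v. M u v - c (b u) (b v) * (y u * y v))"
    unfolding zero_diag_inverse_def
  proof (intro conjI ballI)
    fix u assume u: "u \<in> W"
    show "M u u - c (b u) (b u) * (y u * y u) = 0"
      using zero_diag_inverseD(1)[OF z[OF bI(1)[OF u]] bI(2)[OF u]] c(2)[OF bI(1)[OF u]]
      by (simp add: M_def)
    fix v assume v: "v \<in> W"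
    note uv = bI[OF u] bI[OF v]
    have "A u v = A v u" "M u v = M v u"
      using zero_diag_inverseD(2,3)[OF z[OF uv(1)] uv(2)] uv by (auto simp: A_def M_def)
    moreover have "c (b u) (b v) = c (b v) (b u)" using c uv by blast
    ultimately show "A u v + c (b u) (b v) * (x u * x v) = A v u + c (b v) (b u) * (x v * x u)"
      "M u v - c (b u) (b v) * (y u * y v) = M v u - c (b v) (b u) * (y v * y u)"
      by (simp_all add: mult.commute)
    have 1: "(\<Sum>w\<in>W. A u w * M w v) = of_bool (u = v)"
    proof -
      have "(\<Sum>w\<in>W. A u w * M w v) = (\<Sum>w\<in>W. of_bool (b w = b u) * (a (b u) u w * (of_bool (b u = b v) * m (b u) w v)))"
        by (intro sum.cong refl) (auto simp: A_def M_def)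
      also have "\<dots> = (\<Sum>w\<in>V (b u). a (b u) u w * (of_bool (b u = b v) * m (b u) w v))"
        by (rule block[OF uv(1)])
      also have "\<dots> = of_bool (b u = b v) * (\<Sum>w\<in>V (b u). a (b u) u w * m (b u) w v)"
        by simp
      also have "\<dots> = of_bool (u = v)"
        using zero_diag_inverseD(4)[OF z[OF uv(1)] uv(2), of v] uv by auto
      finally show ?thesis .
    qed
    have 2: "(\<Sum>w\<in>W. A u w * (c (b w) (b v) * (y w * y v))) = c (b u) (b v) * (x u * y v)"
    proof -
      have "(\<Sum>w\<in>W. A u w * (c (b w) (b v) * (y w * y v)))
        = (\<Sum>w\<in>W. of_bool (b w = b u) * (c (b u) (b v) * y v * (a (b u) u w * y w)))"
        by (intro sum.cong refl) (auto simp: A_def)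
      also have "\<dots> = c (b u) (b v) * y v * (\<Sum>w\<in>V (b u). a (b u) u w * y w)"
        unfolding block[OF uv(1)] by (simp add: sum_distrib_left)
      finally show ?thesis using ay[OF uv(1,2)] by simp
    qed
    \<comment> \<open>Symmetry of the block of \<open>m\<close> turns x^T M into the transpose of y
      = M x.\<close>
    have 3: "(\<Sum>w\<in>W. c (b u) (b w) * (x u * x w) * M w v) = c (b u) (b v) * (x u * y v)"
    proof -
      have "(\<Sum>w\<in>W. c (b u) (b w) * (x u * x w) * M w v)
        = (\<Sum>w\<in>W. of_bool (b w = b v) * (c (b u) (b v) * x u * (m (b v) v w * x w)))"
        using zero_diag_inverseD(3)[OF z[OF uv(3)] uv(4)] bI
        by (intro sum.cong refl) (auto simp: M_def, metis)
      also have "\<dots> = c (b u) (b v) * x u * (\<Sum>w\<in>V (b v). m (b v) v w * x w)"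
        unfolding block[OF uv(3)] by (simp add: sum_distrib_left)
      finally show ?thesis by (simp add: y_def)
    qed
    \<comment> \<open>Within one block the coefficients from \<open>c\<close> are constant, so each
      block contributes a multiple of the inner product of x and y there.\<close>
    have 4: "(\<Sum>w\<in>W. c (b u) (b w) * (x u * x w) * (c (b w) (b v) * (y w * y v))) = 0"
    proof -
      have "(\<Sum>w\<in>W. c (b u) (b w) * (x u * x w) * (c (b w) (b v) * (y w * y v)))
        = (\<Sum>i\<in>I. \<Sum>w\<in>V i. c (b u) (b w) * (x u * x w) * (c (b w) (b v) * (y w * y v)))"
        unfolding W_def by (intro sum.UNION_disjoint ballI impI finI fin) (metis b disjoint_iff)+
      also have "\<dots> = (\<Sum>i\<in>I. c (b u) i * c i (b v) * x u * y v * (\<Sum>w\<in>V i. x w * y w))"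
        unfolding sum_distrib_left using b by (intro sum.cong refl) auto
      finally show ?thesis using xy by simp
    qed
    show "(\<Sum>w\<in>W. (A u w + c (b u) (b w) * (x u * x w)) * (M w v - c (b w) (b v) * (y w * y v)))
      = of_bool (u = v)"
      using 1 2 3 4 by (simp add: ring_distribs sum.distrib sum_subtractf)
  qed
  \<comment> \<open>The two summands never overlap: \<open>A\<close> vanishes between different
    blocks, and the zero diagonal of \<open>c\<close> removes the other summand inside a
    block.\<close>
  moreover have "A u v + c (b u) (b v) * (x u * x v)
    = (if b u = b v then a (b u) u v else c (b u) (b v) * (x u * x v))" if "u \<in> W" for u v
    using bI[OF that] c(2) by (auto simp: A_def)
  ultimately have "zero_diag_inverse W
    (\<lambda>u v. if b u = b v then a (b u) u v else c (b u) (b v) * (x u * x v))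
    (\<lambda>u v. M u v - c (b u) (b v) * (y u * y v))"
    by (rule zero_diag_inverse_cong)
  then show ?thesis unfolding W_def by blast
qed

section \<open>Assembling the join from its blocks\<close>

theorem theorem4p2:
  fixes k :: nat
    and H :: "nat pair_pre_digraph"
    and G :: "nat \<Rightarrow> 'a pair_pre_digraph"
  assumes "pair_graph H" and "pverts H = {1..k}"
    and "\<And>i. i \<in> {1..k} \<Longrightarrow> pair_graph (G i)"
    and "disjoint_family_on (\<lambda>i. pverts (G i)) {1..k}"
    and "\<And>i. i \<in> {1..k} \<Longrightarrow> card (pverts (G i)) \<ge> 3"
    and "\<And>i. i \<in> {1..k} \<Longrightarrow> property_P (G i)"
  shows "property_P (H_join H G)"
proof -
  interpret H: pair_graph H by fact
  interpret J: pair_graph "H_join H G"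
    using assms(1-4) by (intro pair_graph_H_join) auto
  define I where "I = {1..k}"
  define V where "V i = pverts (G i)" for i
  \<comment> \<open>Disjointness of the vertex sets makes this index unique.\<close>
  define b where "b u = (THE i. i \<in> I \<and> u \<in> V i)" for u
  have disj: "i = j" if "i \<in> I" "j \<in> I" "u \<in> V i" "u \<in> V j" for i j u
    using assms(4) that unfolding disjoint_family_on_def I_def V_def by blast
  have b: "b u = i" if "i \<in> I" "u \<in> V i" for i u
    unfolding b_def using that disj by (intro the_equality) auto
  have "\<exists>a m. zero_diag_inverse (V i) a m \<and>
      (\<forall>u\<in>V i. \<forall>v\<in>V i. u \<noteq> v \<longrightarrow> (a u v \<noteq> 0 \<longleftrightarrow> (u, v) \<in> parcs (G i)))" if "i \<in> I" for i
    unfolding V_def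
    by (rule property_P_imp_zero_diag_inverse[OF assms(6)[OF that[unfolded I_def]]]) blast
  then have "\<forall>i\<in>I. \<exists>a m. zero_diag_inverse (V i) a m \<and>
      (\<forall>u\<in>V i. \<forall>v\<in>V i. u \<noteq> v \<longrightarrow> (a u v \<noteq> 0 \<longleftrightarrow> (u, v) \<in> parcs (G i)))"
    by blast
  then obtain a m where am: "\<forall>i\<in>I. zero_diag_inverse (V i) (a i) (m i) \<and>
      (\<forall>u\<in>V i. \<forall>v\<in>V i. u \<noteq> v \<longrightarrow> (a i u v \<noteq> 0 \<longleftrightarrow> (u, v) \<in> parcs (G i)))"
    unfolding bchoice_iff by (elim exE)
  then have z: "zero_diag_inverse (V i) (a i) (m i)" if "i \<in> I" for i
    using that by blast
  have edge: "a i u v \<noteq> 0 \<longleftrightarrow> (u, v) \<in> parcs (G i)"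
    if "i \<in> I" "u \<in> V i" "v \<in> V i" "u \<noteq> v" for i u v
    using am that by blast
  have "\<exists>x. (\<forall>u\<in>V i. x u \<noteq> 0) \<and> (\<Sum>u\<in>V i. x u * (\<Sum>v\<in>V i. m i u v * x v)) = 0"
    if "i \<in> I" for i
    using assms(5)[OF that[unfolded I_def]]
    by (intro nowhere_zero_isotropic_vector[OF z[OF that]]) (simp add: V_def)
  then have "\<forall>i\<in>I. \<exists>x. (\<forall>u\<in>V i. x u \<noteq> 0) \<and> (\<Sum>u\<in>V i. x u * (\<Sum>v\<in>V i. m i u v * x v)) = 0"
    by blast
  then obtain xs where xs: "\<forall>i\<in>I. (\<forall>u\<in>V i. xs i u \<noteq> 0)
      \<and> (\<Sum>u\<in>V i. xs i u * (\<Sum>v\<in>V i. m i u v * xs i v)) = 0"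
    unfolding bchoice_iff by (elim exE)
  \<comment> \<open>The isotropic vectors of the blocks, glued into one function on all
    vertices.\<close>
  define x where "x u = xs (b u) u" for u
  have x: "x u \<noteq> 0" if "i \<in> I" "u \<in> V i" for i u
    using xs b that by (simp add: x_def)
  have iso: "(\<Sum>u\<in>V i. x u * (\<Sum>v\<in>V i. m i u v * x v)) = 0" if "i \<in> I" for i
    using bspec[OF xs that] b[OF that] by (simp add: x_def)
  define c :: "nat \<Rightarrow> nat \<Rightarrow> real" where "c i j = of_bool ((i, j) \<in> parcs H)" for i j
  define e where "e u v = (if b u = b v then a (b u) u v else c (b u) (b v) * (x u * x v))" for u v
  have verts: "pverts (H_join H G) = (\<Union>i\<in>I. V i)"
    using assms(2) by (simp add: H_join_def I_def V_def)
  have "c i j = c j i" "c i i = 0" for i j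
    using H.arcs_symmetric H.no_loops' by (auto simp: c_def)
  moreover have "finite (V i)" if "i \<in> I" for i
    using assms(3)[of i] that
    by (simp add: I_def V_def pair_graph_def pair_digraph_def pair_fin_digraph_def
        pair_fin_digraph_axioms_def)
  ultimately obtain n where n: "zero_diag_inverse (pverts (H_join H G)) e n"
    using zero_diag_inverse_join[of I V b a m x c] b z iso unfolding verts e_def I_def by auto
  have inner: "u \<in> V i \<and> v \<in> V i" if "i \<in> I" "(u, v) \<in> parcs (G i)" for i u v
  proof -
    interpret Gi: pair_graph "G i" using assms(3) that I_def by blast
    show ?thesis using that Gi.in_arcsD1 Gi.in_arcsD2 V_def by blast
  qed
  have cross: "i \<in> I \<and> j \<in> I \<and> i \<noteq> j" if "(i, j) \<in> parcs H" for i j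
    using that H.in_arcsD1 H.in_arcsD2 H.no_loops' assms(2) I_def by blast
  have "e u v \<noteq> 0 \<longleftrightarrow> (u, v) \<in> parcs (H_join H G)"
    if uv: "u \<in> pverts (H_join H G)" "v \<in> pverts (H_join H G)" "u \<noteq> v" for u v
  proof -
    obtain i j where ij: "i \<in> I" "j \<in> I" "u \<in> V i" "v \<in> V j"
      using uv verts by auto
    have "(u, v) \<in> parcs (H_join H G) \<longleftrightarrow> (\<exists>l\<in>I. (u, v) \<in> parcs (G l))
        \<or> (\<exists>(p, q)\<in>parcs H. u \<in> V p \<and> v \<in> V q)"
      unfolding H_join_def assms(2) I_def V_def by auto
    \<comment> \<open>By disjointness \<open>p\<close> and \<open>q\<close> can only be the blocks
      \<open>i\<close> and \<open>j\<close> of \<open>u\<close> and \<open>v\<close>.\<close>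
    also have "(\<exists>(p, q)\<in>parcs H. u \<in> V p \<and> v \<in> V q) \<longleftrightarrow> (i, j) \<in> parcs H"
      using ij cross disj by blast
    also have "(\<exists>l\<in>I. (u, v) \<in> parcs (G l)) \<longleftrightarrow> i = j \<and> (u, v) \<in> parcs (G i)"
      using ij inner disj by metis
    finally have arc: "(u, v) \<in> parcs (H_join H G) \<longleftrightarrow> i = j \<and> (u, v) \<in> parcs (G i) \<or> (i, j) \<in> parcs H" .
    have bu: "b u = i" "b v = j" and xu: "x u \<noteq> 0" "x v \<noteq> 0"
      using b x ij by blast+
    show ?thesis
    proof (cases "i = j")
      case True
      then show ?thesis
        unfolding arc using bu edge[of i u v] ij uv(3) cross[of i j] by (simp add: e_def) blast
    next
      \<comment> \<open>Between different blocks the entry is the adjacency entry of H times a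
        product of two nonzero coordinates, so it vanishes exactly when H has no edge there.\<close>
      case False
      then show ?thesis
        unfolding arc using bu xu by (simp add: e_def c_def)
    qed
  qed
  then show ?thesis
    using zero_diag_inverse_imp_property_P[OF J.pair_finite_verts n] by blast
qed

end
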